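(* Let $m\ge0$ and let $\phi$ be a real scalar field on Minkowski spacetime satisfying $(\Box+m^2)\phi=0$. Then the tensor $W^{\alpha\beta\gamma\delta}$ defined in the context satisfies the following positivity property (at each point): for every timelike unit vector $u$, $$W^{\alpha\beta\gamma\delta}u_\alpha u_\beta u_\gamma u_\delta\ \ge\ 0,$$ and $$W^{\alpha\beta\gamma\delta}u_\alpha u_\beta u_\gamma u_\delta=0\ \Longrightarrow\ W^{\alpha\beta\gamma\delta}=0 .$$
   Context: Setting: Minkowski spacetime $\mathbb{R}^4$ with Galilean coordinates and metric $g_{\alpha\beta}=\mathrm{diag}(1,-1,-1,-1)$, used to raise and lower indices; commas denote partial derivatives; $\Box=g^{\alpha\beta}\partial_\alpha\partial_\beta$. Round brackets denote symmetrization with weight one: $X^{(\alpha\beta)}=\frac12(X^{\alpha\beta}+X^{\beta\alpha})$. Timelike unit vector: $g_{\alpha\beta}u^\alpha u^\beta=1$. Define $$\tau^{\alpha\beta}=\phi^{,\alpha\lambda}{\phi^{,\beta}}_{\lambda}-m^2\phi^{,\alpha}\phi^{,\beta}-\tfrac12 K g^{\alpha\beta},\qquad K=\tfrac12\phi^{,\rho\sigma}\phi_{,\rho\sigma}-m^2\phi^{,\lambda}\phi_{,\lambda}+\tfrac12 m^4\phi^2,$$ $$W^{\alpha\beta\gamma\delta}=\tfrac13\left(\phi^{,\alpha\beta}\phi^{,\gamma\delta}+2\phi^{,\alpha(\gamma}\phi^{,\delta)\beta}\right)-\tfrac16\left(g^{\alpha\beta}\tau^{\gamma\delta}+g^{\gamma\delta}\tau^{\alpha\beta}+2g^{\alpha(\gamma}\tau^{\delta)\beta}+2g^{\beta(\gamma}\tau^{\delta)\alpha}\right).$$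 *)

theory Defs
  imports "HOL-Analysis.Analysis"
begin

text \<open>
  Points of Minkowski spacetime are their Galilean coordinates, of type \<open>real ^ 4\<close>.
  Indices have the numeral type \<open>4\<close>, whose elements are 0, 1, 2, 3 (so \<open>4 = 0\<close>);
  the index 0 is the time coordinate. A tensor at a point is the array of its components.
\<close>

type_synonym spacetime = "real ^ 4"

text \<open>
  In Galilean coordinates the covariant and the contravariant metric have the same
  components \<open>diag(1,-1,-1,-1)\<close>, so \<open>\<eta>\<close> serves both to lower and to raise indices.
\<close>

definition \<eta> :: "4 \<Rightarrow> 4 \<Rightarrow> real" where
  "\<eta> \<alpha> \<beta> = (if \<alpha> = \<beta> then (if \<alpha> = 0 then 1 else - 1) else 0)"

definition timelike_unit :: "real ^ 4 \<Rightarrow> bool" where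
  "timelike_unit u \<longleftrightarrow> (\<Sum>\<alpha>\<in>UNIV. \<Sum>\<beta>\<in>UNIV. \<eta> \<alpha> \<beta> * u $ \<alpha> * u $ \<beta>) = 1"

definition lower :: "real ^ 4 \<Rightarrow> 4 \<Rightarrow> real" where
  "lower u \<alpha> = (\<Sum>\<beta>\<in>UNIV. \<eta> \<alpha> \<beta> * u $ \<beta>)"

definition partial :: "4 \<Rightarrow> (spacetime \<Rightarrow> real) \<Rightarrow> spacetime \<Rightarrow> real" where
  "partial \<alpha> f x = deriv (\<lambda>t. f (x + t *\<^sub>R axis \<alpha> 1)) 0"

definition C2_field :: "(spacetime \<Rightarrow> real) \<Rightarrow> bool" where
  "C2_field \<phi> \<longleftrightarrow>
     \<phi> differentiable_on UNIV \<and>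
     (\<forall>\<alpha>. partial \<alpha> \<phi> differentiable_on UNIV) \<and>
     (\<forall>\<alpha> \<beta>. continuous_on UNIV (partial \<beta> (partial \<alpha> \<phi>)))"

text \<open>
  Derivatives of \<open>\<phi>\<close>: the letters d and u in a name give the position (down or up) of the
  successive indices, so \<open>D_ud \<phi> x \<alpha> \<beta>\<close> is the component with the index \<open>\<alpha>\<close> raised.
\<close>

definition D_d :: "(spacetime \<Rightarrow> real) \<Rightarrow> spacetime \<Rightarrow> 4 \<Rightarrow> real" where
  "D_d \<phi> x \<alpha> = partial \<alpha> \<phi> x"

definition D_u :: "(spacetime \<Rightarrow> real) \<Rightarrow> spacetime \<Rightarrow> 4 \<Rightarrow> real" where
  "D_u \<phi> x \<alpha> = (\<Sum>\<rho>\<in>UNIV. \<eta> \<alpha> \<rho> * D_d \<phi> x \<rho>)"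

definition D_dd :: "(spacetime \<Rightarrow> real) \<Rightarrow> spacetime \<Rightarrow> 4 \<Rightarrow> 4 \<Rightarrow> real" where
  "D_dd \<phi> x \<alpha> \<beta> = partial \<beta> (partial \<alpha> \<phi>) x"

definition D_ud :: "(spacetime \<Rightarrow> real) \<Rightarrow> spacetime \<Rightarrow> 4 \<Rightarrow> 4 \<Rightarrow> real" where
  "D_ud \<phi> x \<alpha> \<beta> = (\<Sum>\<rho>\<in>UNIV. \<eta> \<alpha> \<rho> * D_dd \<phi> x \<rho> \<beta>)"

definition D_uu :: "(spacetime \<Rightarrow> real) \<Rightarrow> spacetime \<Rightarrow> 4 \<Rightarrow> 4 \<Rightarrow> real" where
  "D_uu \<phi> x \<alpha> \<beta> = (\<Sum>\<rho>\<in>UNIV. \<Sum>\<sigma>\<in>UNIV. \<eta> \<alpha> \<rho> * \<eta> \<beta> \<sigma> * D_dd \<phi> x \<rho> \<sigma>)"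

definition box :: "(spacetime \<Rightarrow> real) \<Rightarrow> spacetime \<Rightarrow> real" where
  "box \<phi> x = (\<Sum>\<alpha>\<in>UNIV. \<Sum>\<beta>\<in>UNIV. \<eta> \<alpha> \<beta> * partial \<alpha> (partial \<beta> \<phi>) x)"

definition klein_gordon :: "real \<Rightarrow> (spacetime \<Rightarrow> real) \<Rightarrow> bool" where
  "klein_gordon m \<phi> \<longleftrightarrow> (\<forall>x. box \<phi> x + m\<^sup>2 * \<phi> x = 0)"

definition K :: "real \<Rightarrow> (spacetime \<Rightarrow> real) \<Rightarrow> spacetime \<Rightarrow> real" where
  "K m \<phi> x =
     1/2 * (\<Sum>\<rho>\<in>UNIV. \<Sum>\<sigma>\<in>UNIV. D_uu \<phi> x \<rho> \<sigma> * D_dd \<phi> x \<rho> \<sigma>)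
     - m\<^sup>2 * (\<Sum>\<kappa>\<in>UNIV. D_u \<phi> x \<kappa> * D_d \<phi> x \<kappa>)
     + 1/2 * m^4 * (\<phi> x)\<^sup>2"

definition \<tau> :: "real \<Rightarrow> (spacetime \<Rightarrow> real) \<Rightarrow> spacetime \<Rightarrow> 4 \<Rightarrow> 4 \<Rightarrow> real" where
  "\<tau> m \<phi> x \<alpha> \<beta> =
     (\<Sum>\<kappa>\<in>UNIV. D_uu \<phi> x \<alpha> \<kappa> * D_ud \<phi> x \<beta> \<kappa>)
     - m\<^sup>2 * D_u \<phi> x \<alpha> * D_u \<phi> x \<beta>
     - 1/2 * K m \<phi> x * \<eta> \<alpha> \<beta>"

definition symmetrize :: "(4 \<Rightarrow> 4 \<Rightarrow> real) \<Rightarrow> 4 \<Rightarrow> 4 \<Rightarrow> real" where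
  "symmetrize X \<alpha> \<beta> = 1/2 * (X \<alpha> \<beta> + X \<beta> \<alpha>)"

definition W :: "real \<Rightarrow> (spacetime \<Rightarrow> real) \<Rightarrow> spacetime \<Rightarrow> 4 \<Rightarrow> 4 \<Rightarrow> 4 \<Rightarrow> 4 \<Rightarrow> real" where
  "W m \<phi> x \<alpha> \<beta> \<gamma> \<delta> =
     1/3 * (D_uu \<phi> x \<alpha> \<beta> * D_uu \<phi> x \<gamma> \<delta>
            + 2 * symmetrize (\<lambda>\<gamma> \<delta>. D_uu \<phi> x \<alpha> \<gamma> * D_uu \<phi> x \<delta> \<beta>) \<gamma> \<delta>)
     - 1/6 * (\<eta> \<alpha> \<beta> * \<tau> m \<phi> x \<gamma> \<delta> + \<eta> \<gamma> \<delta> * \<tau> m \<phi> x \<alpha> \<beta>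
              + 2 * symmetrize (\<lambda>\<gamma> \<delta>. \<eta> \<alpha> \<gamma> * \<tau> m \<phi> x \<delta> \<beta>) \<gamma> \<delta>
              + 2 * symmetrize (\<lambda>\<gamma> \<delta>. \<eta> \<beta> \<gamma> * \<tau> m \<phi> x \<delta> \<alpha>) \<gamma> \<delta>)"

definition contract4 :: "(4 \<Rightarrow> 4 \<Rightarrow> 4 \<Rightarrow> 4 \<Rightarrow> real) \<Rightarrow> real ^ 4 \<Rightarrow> real" where
  "contract4 T u =
     (\<Sum>\<alpha>\<in>UNIV. \<Sum>\<beta>\<in>UNIV. \<Sum>\<gamma>\<in>UNIV. \<Sum>\<delta>\<in>UNIV.
        T \<alpha> \<beta> \<gamma> \<delta> * lower u \<alpha> * lower u \<beta> * lower u \<gamma> * lower u \<delta>)"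

end

theory Submission
  imports Defs
begin

text \<open>
  For a unit timelike \<open>u\<close> the form \<open>h = 2 u u - \<eta>\<close> is positive definite: it is \<open>\<Sum>\<^sub>a E\<^sub>a E\<^sub>a\<close> for an
  orthonormal frame \<open>E\<close> with \<open>E\<^sub>0 = u\<close>. Since \<open>\<phi>\<^sub>,\<^sub>\<alpha>\<^sub>\<beta>\<close> is symmetric, the full contraction of \<open>W\<close>
  with \<open>u\<close> equals
  \<open>1/4 h h \<phi>\<^sub>,\<^sub>\<alpha>\<^sub>\<beta> \<phi>\<^sub>,\<^sub>\<gamma>\<^sub>\<delta> + 1/2 m\<^sup>2 h \<phi>\<^sub>,\<^sub>\<alpha> \<phi>\<^sub>,\<^sub>\<beta> + 1/4 m\<^sup>4 \<phi>\<^sup>2\<close>,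
  a sum of squares. If it vanishes, then so do \<open>\<phi>\<^sub>,\<^sub>\<alpha>\<^sub>\<beta>\<close>, \<open>m \<phi>\<^sub>,\<^sub>\<alpha>\<close> and \<open>m\<^sup>2 \<phi>\<close>, out of which \<open>W\<close>
  is built.
\<close>

section \<open>Symmetry of second derivatives\<close>

text \<open>Two applications of the mean value theorem: first in \<open>s\<close> to the difference
  \<open>F s h - F s 0\<close>, then in \<open>t\<close> to \<open>F1 z\<close>. The result involves
  only the mixed derivative taken in this order, while the double difference on the left treats both
  variables alike.\<close>

lemma double_difference_mvt:
  fixes F :: "real \<Rightarrow> real \<Rightarrow> real"
  assumes "h > 0"
    and F1: "\<And>s t. ((\<lambda>s. F s t) has_real_derivative F1 s t) (at s)"
    and F12: "\<And>s t. ((\<lambda>t. F1 s t) has_real_derivative F12 s t) (at t)"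
  shows "\<exists>z w. 0 < z \<and> z < h \<and> 0 < w \<and> w < h \<and>
           F h h - F h 0 - F 0 h + F 0 0 = h * h * F12 z w"
proof -
  have "((\<lambda>s. F s h - F s 0) has_real_derivative F1 s h - F1 s 0) (at s)" for s
    by (intro derivative_intros F1)
  from MVT2[OF \<open>h > 0\<close> this] obtain z where
    z: "0 < z" "z < h" "F h h - F h 0 - (F 0 h - F 0 0) = h * (F1 z h - F1 z 0)"
    by auto
  from MVT2[OF \<open>h > 0\<close> F12[of z]] obtain w where
    w: "0 < w" "w < h" "F1 z h - F1 z 0 = h * F12 z w"
    by auto
  have "F h h - F h 0 - F 0 h + F 0 0 = h * h * F12 z w"
    using z(3) w(3) by (simp add: algebra_simps)
  with z w show ?thesis by blast
qed

text \<open>The definition of \<open>partial\<close> differentiates at parameter 0 of a line through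
  the given point. Shifting the parameter gives the derivative at every point of one fixed line,
  which is the form needed for the mean value theorem.\<close>

lemma has_real_derivative_partial:
  assumes "f differentiable_on UNIV"
  shows "((\<lambda>t. f (x + t *\<^sub>R axis \<alpha> 1)) has_real_derivative
           partial \<alpha> f (x + t *\<^sub>R axis \<alpha> 1)) (at t)"
proof -
  let ?e = "axis \<alpha> 1 :: spacetime"
  have df: "f differentiable at y" for y
    using assms by (simp add: differentiable_on_def)
  have "(\<lambda>r. f ((x + t *\<^sub>R ?e) + r *\<^sub>R ?e)) differentiable at 0"
    by (rule differentiable_compose[where f = f]) (auto intro!: derivative_intros df)
  hence "((\<lambda>r. f ((x + t *\<^sub>R ?e) + r *\<^sub>R ?e)) has_real_derivative
           partial \<alpha> f (x + t *\<^sub>R ?e)) (at (t - t))"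
    unfolding partial_def
    by (simp add: DERIV_deriv_iff_real_differentiable)
  hence "((\<lambda>r. f ((x + t *\<^sub>R ?e) + (r + (- t)) *\<^sub>R ?e)) has_real_derivative
           partial \<alpha> f (x + t *\<^sub>R ?e)) (at t)"
    using DERIV_shift[of "\<lambda>r. f ((x + t *\<^sub>R ?e) + r *\<^sub>R ?e)" _ t "- t"] by simp
  thus ?thesis by (simp add: algebra_simps)
qed

text \<open>Schwarz's theorem: the double difference of \<phi> over a square of side h, divided by
  the square of h, tends to the mixed derivative in either order as h tends to 0.\<close>

lemma partial_commute:
  assumes "C2_field \<phi>"
  shows "partial \<beta> (partial \<alpha> \<phi>) x = partial \<alpha> (partial \<beta> \<phi>) x"
proof -
  let ?e = "\<lambda>\<alpha>. axis \<alpha> 1 :: spacetime"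
  define G where "G = (\<lambda>\<alpha> \<beta>. partial \<beta> (partial \<alpha> \<phi>))"
  have diff: "\<phi> differentiable_on UNIV" "\<And>\<alpha>. partial \<alpha> \<phi> differentiable_on UNIV"
    and cont: "\<And>\<alpha> \<beta>. continuous_on UNIV (G \<alpha> \<beta>)"
    using assms by (auto simp: C2_field_def G_def)
  have mvt: "\<exists>z w. 0 < z \<and> z < h \<and> 0 < w \<and> w < h \<and>
      \<phi> (x + h *\<^sub>R ?e \<alpha> + h *\<^sub>R ?e \<beta>) - \<phi> (x + h *\<^sub>R ?e \<alpha>) - \<phi> (x + h *\<^sub>R ?e \<beta>) + \<phi> x
        = h * h * G \<alpha> \<beta> (x + z *\<^sub>R ?e \<alpha> + w *\<^sub>R ?e \<beta>)"
    if "h > 0" for h and \<alpha> \<beta> :: 4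
  proof -
    have "((\<lambda>s. \<phi> (x + s *\<^sub>R ?e \<alpha> + t *\<^sub>R ?e \<beta>)) has_real_derivative
            partial \<alpha> \<phi> (x + s *\<^sub>R ?e \<alpha> + t *\<^sub>R ?e \<beta>)) (at s)" for s t
      using has_real_derivative_partial[OF diff(1), of "x + t *\<^sub>R ?e \<beta>"]
      by (simp add: algebra_simps)
    moreover have "((\<lambda>t. partial \<alpha> \<phi> (x + s *\<^sub>R ?e \<alpha> + t *\<^sub>R ?e \<beta>)) has_real_derivative
            G \<alpha> \<beta> (x + s *\<^sub>R ?e \<alpha> + t *\<^sub>R ?e \<beta>)) (at t)" for s t
      unfolding G_def by (rule has_real_derivative_partial[OF diff(2)])
    ultimately show ?thesis
      using double_difference_mvt[OF that, of "\<lambda>s t. \<phi> (x + s *\<^sub>R ?e \<alpha> + t *\<^sub>R ?e \<beta>)"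
          "\<lambda>s t. partial \<alpha> \<phi> (x + s *\<^sub>R ?e \<alpha> + t *\<^sub>R ?e \<beta>)"
          "\<lambda>s t. G \<alpha> \<beta> (x + s *\<^sub>R ?e \<alpha> + t *\<^sub>R ?e \<beta>)"]
      by simp
  qed
  define h :: "nat \<Rightarrow> real" where "h n = inverse (real (Suc n))" for n
  have h: "h n > 0" for n by (simp add: h_def)
  have h0: "h \<longlonglongrightarrow> 0" unfolding h_def by (rule LIMSEQ_inverse_real_of_nat)
  have lim: "(\<lambda>n. (\<phi> (x + h n *\<^sub>R ?e \<alpha> + h n *\<^sub>R ?e \<beta>) - \<phi> (x + h n *\<^sub>R ?e \<alpha>)
      - \<phi> (x + h n *\<^sub>R ?e \<beta>) + \<phi> x) / (h n * h n)) \<longlonglongrightarrow> G \<alpha> \<beta> x" for \<alpha> \<beta>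
  proof -
    \<comment> \<open>The two intermediate parameters are packed into one pair, so that a single use
      of \<open>choice\<close> selects both as sequences.\<close>
    have "\<forall>n. \<exists>p. 0 < fst p \<and> fst p < h n \<and> 0 < snd p \<and> snd p < h n \<and>
      \<phi> (x + h n *\<^sub>R ?e \<alpha> + h n *\<^sub>R ?e \<beta>) - \<phi> (x + h n *\<^sub>R ?e \<alpha>)
        - \<phi> (x + h n *\<^sub>R ?e \<beta>) + \<phi> x
        = h n * h n * G \<alpha> \<beta> (x + fst p *\<^sub>R ?e \<alpha> + snd p *\<^sub>R ?e \<beta>)"
      using mvt[OF h] by (simp add: split_paired_Ex)
    then obtain p where p: "\<forall>n. 0 < fst (p n) \<and> fst (p n) < h n \<and> 0 < snd (p n) \<and> snd (p n) < h n \<and>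
      \<phi> (x + h n *\<^sub>R ?e \<alpha> + h n *\<^sub>R ?e \<beta>) - \<phi> (x + h n *\<^sub>R ?e \<alpha>)
        - \<phi> (x + h n *\<^sub>R ?e \<beta>) + \<phi> x
        = h n * h n * G \<alpha> \<beta> (x + fst (p n) *\<^sub>R ?e \<alpha> + snd (p n) *\<^sub>R ?e \<beta>)"
      by (rule choice[THEN exE])
    define z w where "z n = fst (p n)" and "w n = snd (p n)" for n
    have zw: "0 < z n" "z n < h n" "0 < w n" "w n < h n"
      and eq: "\<phi> (x + h n *\<^sub>R ?e \<alpha> + h n *\<^sub>R ?e \<beta>) - \<phi> (x + h n *\<^sub>R ?e \<alpha>)
        - \<phi> (x + h n *\<^sub>R ?e \<beta>) + \<phi> x = h n * h n * G \<alpha> \<beta> (x + z n *\<^sub>R ?e \<alpha> + w n *\<^sub>R ?e \<beta>)" for n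
      using p by (simp_all add: z_def w_def)
    have z0: "z \<longlonglongrightarrow> 0" and w0: "w \<longlonglongrightarrow> 0"
      using zw by (auto intro!: tendsto_sandwich[OF _ _ tendsto_const h0] always_eventually
                        simp: less_imp_le)
    have "(\<lambda>n. x + z n *\<^sub>R ?e \<alpha> + w n *\<^sub>R ?e \<beta>) \<longlonglongrightarrow> x + 0 *\<^sub>R ?e \<alpha> + 0 *\<^sub>R ?e \<beta>"
      by (intro tendsto_intros z0 w0)
    hence "(\<lambda>n. G \<alpha> \<beta> (x + z n *\<^sub>R ?e \<alpha> + w n *\<^sub>R ?e \<beta>)) \<longlonglongrightarrow> G \<alpha> \<beta> x"
      using continuous_on_tendsto_compose[OF cont] by fastforce
    thus ?thesis using h by (simp add: eq less_imp_neq[symmetric])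
  qed
  \<comment> \<open>The quotient is unchanged when the two directions are exchanged, so the same
    sequence also has the other mixed derivative as its limit.\<close>
  have "(\<lambda>n. (\<phi> (x + h n *\<^sub>R ?e \<alpha> + h n *\<^sub>R ?e \<beta>) - \<phi> (x + h n *\<^sub>R ?e \<alpha>)
      - \<phi> (x + h n *\<^sub>R ?e \<beta>) + \<phi> x) / (h n * h n)) \<longlonglongrightarrow> G \<beta> \<alpha> x"
    using lim[of \<beta> \<alpha>] by (simp add: algebra_simps)
  with lim[of \<alpha> \<beta>] show ?thesis
    unfolding G_def by (rule LIMSEQ_unique)
qed

section \<open>The positive definite form of an observer\<close>

lemma \<eta>_square [simp]: "\<eta> \<alpha> \<alpha> * \<eta> \<alpha> \<alpha> = 1"
  by (simp add: \<eta>_def)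

lemma \<eta>_square_mult [simp]: "\<eta> \<alpha> \<alpha> * (\<eta> \<alpha> \<alpha> * r) = r"
  by (simp add: \<eta>_def)

text \<open>The metric is diagonal, so raising or lowering an index only multiplies by the sign
  \<open>\<eta> \<alpha> \<alpha>\<close>. As a simp rule this removes the metric sums from the
  definitions.\<close>

lemma sum_\<eta> [simp]: "(\<Sum>\<beta>\<in>UNIV. \<eta> \<alpha> \<beta> * f \<beta>) = \<eta> \<alpha> \<alpha> * f \<alpha>"
proof -
  have "(\<Sum>\<beta>\<in>UNIV. \<eta> \<alpha> \<beta> * f \<beta>) = (\<Sum>\<beta>\<in>UNIV. if \<alpha> = \<beta> then \<eta> \<alpha> \<alpha> * f \<alpha> else 0)"
    by (intro sum.cong) (auto simp: \<eta>_def)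
  thus ?thesis by simp
qed

lemma lower_eq: "lower u \<alpha> = \<eta> \<alpha> \<alpha> * u $ \<alpha>"
  by (simp add: lower_def)

lemma timelike_unit_alt: "timelike_unit u \<longleftrightarrow> (\<Sum>\<alpha>\<in>UNIV. \<eta> \<alpha> \<alpha> * (u $ \<alpha>)\<^sup>2) = 1"
proof -
  have "(\<Sum>\<beta>\<in>UNIV. \<eta> \<alpha> \<beta> * u $ \<alpha> * u $ \<beta>) = \<eta> \<alpha> \<alpha> * (u $ \<alpha>)\<^sup>2" for \<alpha>
    using sum_\<eta>[of \<alpha> "\<lambda>\<beta>. u $ \<alpha> * u $ \<beta>"] by (simp add: mult.assoc power2_eq_square)
  thus ?thesis by (simp add: timelike_unit_def)
qed

lemma UNIV_4_eq: "(UNIV :: 4 set) = {0, 1, 2, 3}"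
proof -
  \<comment> \<open>\<open>exhaust_4\<close> lists the indices as 1, 2, 3, 4; the last of these is
    the time index 0.\<close>
  have "(4 :: 4) = 0" by simp
  with exhaust_4 show ?thesis by fastforce
qed

lemma sum_4_from_0: "(\<Sum>\<alpha>\<in>(UNIV :: 4 set). f \<alpha>) = f 0 + f 1 + f 2 + f 3"
  unfolding UNIV_4_eq by (simp add: add.assoc)

text \<open>The rows of \<open>E\<close> are the axes of the pure boost to the rest frame of \<open>u\<close>;
  a past-pointing \<open>u\<close> is reduced to \<open>- u\<close>.\<close>

lemma rest_frame_exists:
  assumes "timelike_unit u"
  obtains E :: "4 \<Rightarrow> 4 \<Rightarrow> real"
  where "\<And>\<alpha>. E 0 \<alpha> = u $ \<alpha>"
    and "\<And>\<alpha> \<beta>. (\<Sum>a\<in>UNIV. E a \<alpha> * E a \<beta>) = 2 * u $ \<alpha> * u $ \<beta> - \<eta> \<alpha> \<beta>"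
proof -
  have future: "\<exists>E :: 4 \<Rightarrow> 4 \<Rightarrow> real. (\<forall>\<alpha>. E 0 \<alpha> = u $ \<alpha>) \<and>
      (\<forall>\<alpha> \<beta>. (\<Sum>a\<in>UNIV. E a \<alpha> * E a \<beta>) = 2 * u $ \<alpha> * u $ \<beta> - \<eta> \<alpha> \<beta>)"
    if u: "timelike_unit u" and "u $ 0 \<ge> 0" for u
  proof -
    define E :: "4 \<Rightarrow> 4 \<Rightarrow> real" where
      "E a \<alpha> = (if a = 0 then u $ \<alpha> else if \<alpha> = 0 then u $ a
                 else (if a = \<alpha> then 1 else 0) + u $ a * u $ \<alpha> / (1 + u $ 0))" for a \<alpha>
    define k where "k = 1 / (1 + u $ 0)"
    have k: "k * (1 + u $ 0) = 1" using that by (simp add: k_def)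
    have n: "(u $ 0)\<^sup>2 = 1 + (u $ 1)\<^sup>2 + (u $ 2)\<^sup>2 + (u $ 3)\<^sup>2"
      using u by (simp add: timelike_unit_alt sum_4_from_0 \<eta>_def)
    \<comment> \<open>With r the sum of the spatial squares, normalization gives r =
      (\<open>u $ 0\<close> - 1)(\<open>u $ 0\<close> + 1), and \<open>k\<close> is the inverse of
      the second factor.\<close>
    have k1: "((u $ 1)\<^sup>2 + (u $ 2)\<^sup>2 + (u $ 3)\<^sup>2) * k = u $ 0 - 1"
      and k2: "((u $ 1)\<^sup>2 + (u $ 2)\<^sup>2 + (u $ 3)\<^sup>2) * k\<^sup>2 = 1 - 2 * k"
      using n k by algebra+
    have Ek: "E a \<alpha> = (if a = 0 then u $ \<alpha> else if \<alpha> = 0 then u $ a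
                 else (if a = \<alpha> then 1 else 0) + u $ a * u $ \<alpha> * k)" for a \<alpha>
      by (simp add: E_def k_def)
    have "(\<Sum>a\<in>UNIV. E a \<alpha> * E a \<beta>) = 2 * u $ \<alpha> * u $ \<beta> - \<eta> \<alpha> \<beta>" for \<alpha> \<beta>
    proof -
      let ?r = "(u $ 1)\<^sup>2 + (u $ 2)\<^sup>2 + (u $ 3)\<^sup>2"
      \<comment> \<open>Once the frame sums are multiplied out, \<open>k\<close> times r occurs with
        one spatial component of \<open>u\<close> as factor, and the square of \<open>k\<close>
        times r with two. With these products replaced, each of the sixteen index cases is linear in
        the remaining monomials.\<close>
      have "u $ \<alpha> * (?r * k) = u $ \<alpha> * (u $ 0 - 1)" "u $ \<beta> * (?r * k) = u $ \<beta> * (u $ 0 - 1)"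
        "u $ \<alpha> * u $ \<beta> * (?r * k\<^sup>2) = u $ \<alpha> * u $ \<beta> * (1 - 2 * k)"
        by (simp_all only: k1 k2)
      moreover have "\<alpha> \<in> {0, 1, 2, 3}" "\<beta> \<in> {0, 1, 2, 3}" using UNIV_4_eq by auto
      ultimately show ?thesis
        using n by (elim insertE emptyE;
            simp add: sum_4_from_0 Ek \<eta>_def ring_distribs power2_eq_square mult_ac)
    qed
    moreover have "E 0 \<alpha> = u $ \<alpha>" for \<alpha> by (simp add: E_def)
    ultimately show ?thesis by blast
  qed
  show ?thesis
  proof (cases "u $ 0 \<ge> 0")
    case True
    with future[OF assms] that show ?thesis by blast
  next
    case False
    have "timelike_unit (- u)" using assms by (simp add: timelike_unit_alt)
    with future[of "- u"] False obtain E :: "4 \<Rightarrow> 4 \<Rightarrow> real" where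
      "\<And>\<alpha>. E 0 \<alpha> = - u $ \<alpha>"
      "\<And>\<alpha> \<beta>. (\<Sum>a\<in>UNIV. E a \<alpha> * E a \<beta>) = 2 * u $ \<alpha> * u $ \<beta> - \<eta> \<alpha> \<beta>"
      by auto
    with that[of "\<lambda>a \<alpha>. - E a \<alpha>"] show ?thesis by simp
  qed
qed

section \<open>Sums of squares of frame components\<close>

context
  fixes u :: "real ^ 4" and E :: "4 \<Rightarrow> 4 \<Rightarrow> real"
  assumes E0: "\<And>\<alpha>. E 0 \<alpha> = u $ \<alpha>"
    and EE: "\<And>\<alpha> \<beta>. (\<Sum>a\<in>UNIV. E a \<alpha> * E a \<beta>) = 2 * u $ \<alpha> * u $ \<beta> - \<eta> \<alpha> \<beta>"
begin

text \<open>Exchanging the sums lets \<open>EE\<close> eliminate the frame: this is h = 2 u u -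
  \<eta> applied to \<open>w\<close>. The next two lemmas rest on it.\<close>

lemma sum_frame_mult:
  "(\<Sum>a\<in>UNIV. E a \<beta> * (\<Sum>\<alpha>\<in>UNIV. E a \<alpha> * w \<alpha>))
     = 2 * u $ \<beta> * (\<Sum>\<alpha>\<in>UNIV. u $ \<alpha> * w \<alpha>) - \<eta> \<beta> \<beta> * w \<beta>"
proof -
  have "(\<Sum>a\<in>UNIV. E a \<beta> * (\<Sum>\<alpha>\<in>UNIV. E a \<alpha> * w \<alpha>))
      = (\<Sum>\<alpha>\<in>UNIV. (\<Sum>a\<in>UNIV. E a \<beta> * E a \<alpha>) * w \<alpha>)"
    by (simp add: sum_distrib_left sum_distrib_right mult.assoc) (rule sum.swap)
  also have "\<dots> = (\<Sum>\<alpha>\<in>UNIV. 2 * u $ \<beta> * (u $ \<alpha> * w \<alpha>) - \<eta> \<beta> \<alpha> * w \<alpha>)"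
    by (simp only: EE left_diff_distrib mult.assoc)
  also have "\<dots> = 2 * u $ \<beta> * (\<Sum>\<alpha>\<in>UNIV. u $ \<alpha> * w \<alpha>) - \<eta> \<beta> \<beta> * w \<beta>"
    by (simp add: sum_subtractf flip: sum_distrib_left)
  finally show ?thesis .
qed

text \<open>In \<open>sum_frame_mult\<close> the left side vanishes, and so does the term with
  \<open>u\<close>, since it contains the component along \<open>E 0\<close>, which is
  \<open>u\<close>. What remains is \<open>w \<beta>\<close> up to sign, so no inverse of the frame
  has to be constructed.\<close>

lemma frame_components_eq_0:
  assumes "\<And>a. (\<Sum>\<alpha>\<in>UNIV. E a \<alpha> * w \<alpha>) = 0"
  shows "w \<beta> = 0"
proof -
  have "\<eta> \<beta> \<beta> * w \<beta> = 0"
    using sum_frame_mult[of \<beta> w] assms[of 0] by (simp add: assms E0)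
  thus ?thesis by (simp add: \<eta>_def split: if_splits)
qed

lemma sum_frame_square:
  "(\<Sum>a\<in>UNIV. (\<Sum>\<alpha>\<in>UNIV. E a \<alpha> * w \<alpha>)\<^sup>2)
     = 2 * (\<Sum>\<alpha>\<in>UNIV. u $ \<alpha> * w \<alpha>)\<^sup>2 - (\<Sum>\<alpha>\<in>UNIV. \<eta> \<alpha> \<alpha> * (w \<alpha>)\<^sup>2)"
proof -
  define r where "r a = (\<Sum>\<alpha>\<in>UNIV. E a \<alpha> * w \<alpha>)" for a
  have "(\<Sum>a\<in>UNIV. (r a)\<^sup>2) = (\<Sum>a\<in>UNIV. \<Sum>\<beta>\<in>UNIV. w \<beta> * (E a \<beta> * r a))"
  proof (rule sum.cong)
    fix a
    have "(r a)\<^sup>2 = (\<Sum>\<beta>\<in>UNIV. E a \<beta> * w \<beta>) * r a"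
      by (simp add: r_def power2_eq_square)
    thus "(r a)\<^sup>2 = (\<Sum>\<beta>\<in>UNIV. w \<beta> * (E a \<beta> * r a))"
      by (simp add: sum_distrib_right sum_distrib_left mult_ac)
  qed simp
  also have "\<dots> = (\<Sum>\<beta>\<in>UNIV. w \<beta> * (\<Sum>a\<in>UNIV. E a \<beta> * r a))"
    by (subst sum.swap) (simp add: sum_distrib_left)
  also have "\<dots> = (\<Sum>\<beta>\<in>UNIV. 2 * (\<Sum>\<alpha>\<in>UNIV. u $ \<alpha> * w \<alpha>) * (u $ \<beta> * w \<beta>) - \<eta> \<beta> \<beta> * (w \<beta>)\<^sup>2)"
    unfolding r_def sum_frame_mult by (simp add: algebra_simps power2_eq_square)
  also have "\<dots> = 2 * (\<Sum>\<alpha>\<in>UNIV. u $ \<alpha> * w \<alpha>)\<^sup>2 - (\<Sum>\<alpha>\<in>UNIV. \<eta> \<alpha> \<alpha> * (w \<alpha>)\<^sup>2)"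
    by (simp add: sum_subtractf power2_eq_square flip: sum_distrib_left)
  finally show ?thesis by (simp add: r_def)
qed

text \<open>\<open>sum_frame_square\<close> is applied once for each index of \<open>A\<close>. The
  symmetry of \<open>A\<close> makes the two cross terms equal, whence the coefficient 4 in the
  middle.\<close>

lemma sum_frame_square2:
  assumes sym: "\<And>\<alpha> \<beta>. A \<alpha> \<beta> = A \<beta> \<alpha>"
  shows "(\<Sum>b\<in>UNIV. \<Sum>a\<in>UNIV. (\<Sum>\<alpha>\<in>UNIV. E a \<alpha> * (\<Sum>\<beta>\<in>UNIV. E b \<beta> * A \<alpha> \<beta>))\<^sup>2)
     = 4 * (\<Sum>\<alpha>\<in>UNIV. u $ \<alpha> * (\<Sum>\<beta>\<in>UNIV. u $ \<beta> * A \<alpha> \<beta>))\<^sup>2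
       - 4 * (\<Sum>\<alpha>\<in>UNIV. \<eta> \<alpha> \<alpha> * (\<Sum>\<beta>\<in>UNIV. u $ \<beta> * A \<alpha> \<beta>)\<^sup>2)
       + (\<Sum>\<alpha>\<in>UNIV. \<Sum>\<beta>\<in>UNIV. \<eta> \<alpha> \<alpha> * \<eta> \<beta> \<beta> * (A \<alpha> \<beta>)\<^sup>2)"
proof -
  define p where "p \<alpha> = (\<Sum>\<beta>\<in>UNIV. u $ \<beta> * A \<alpha> \<beta>)" for \<alpha>
  \<comment> \<open>By symmetry \<open>u\<close> may be moved to the second index of
    \<open>A\<close>, which turns the sum into a frame component of \<open>p\<close>.\<close>
  have swap: "(\<Sum>\<alpha>\<in>UNIV. u $ \<alpha> * (\<Sum>\<beta>\<in>UNIV. E b \<beta> * A \<alpha> \<beta>)) = (\<Sum>\<beta>\<in>UNIV. E b \<beta> * p \<beta>)" for b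
  proof -
    have "(\<Sum>\<alpha>\<in>UNIV. u $ \<alpha> * (\<Sum>\<beta>\<in>UNIV. E b \<beta> * A \<alpha> \<beta>))
        = (\<Sum>\<beta>\<in>UNIV. \<Sum>\<alpha>\<in>UNIV. u $ \<alpha> * (E b \<beta> * A \<alpha> \<beta>))"
      by (subst sum.swap) (simp add: sum_distrib_left)
    also have "\<dots> = (\<Sum>\<beta>\<in>UNIV. E b \<beta> * p \<beta>)"
      by (simp add: p_def sum_distrib_left mult_ac sym)
    finally show ?thesis .
  qed
  have "(\<Sum>b\<in>UNIV. \<Sum>a\<in>UNIV. (\<Sum>\<alpha>\<in>UNIV. E a \<alpha> * (\<Sum>\<beta>\<in>UNIV. E b \<beta> * A \<alpha> \<beta>))\<^sup>2)
      = 2 * (\<Sum>b\<in>UNIV. (\<Sum>\<beta>\<in>UNIV. E b \<beta> * p \<beta>)\<^sup>2)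
        - (\<Sum>b\<in>UNIV. \<Sum>\<alpha>\<in>UNIV. \<eta> \<alpha> \<alpha> * (\<Sum>\<beta>\<in>UNIV. E b \<beta> * A \<alpha> \<beta>)\<^sup>2)"
    by (simp add: sum_frame_square swap sum_subtractf flip: sum_distrib_left)
  also have "(\<Sum>b\<in>UNIV. \<Sum>\<alpha>\<in>UNIV. \<eta> \<alpha> \<alpha> * (\<Sum>\<beta>\<in>UNIV. E b \<beta> * A \<alpha> \<beta>)\<^sup>2)
      = (\<Sum>\<alpha>\<in>UNIV. \<eta> \<alpha> \<alpha> * (\<Sum>b\<in>UNIV. (\<Sum>\<beta>\<in>UNIV. E b \<beta> * A \<alpha> \<beta>)\<^sup>2))"
    by (subst sum.swap) (simp add: sum_distrib_left)
  also have "\<dots> = 2 * (\<Sum>\<alpha>\<in>UNIV. \<eta> \<alpha> \<alpha> * (p \<alpha>)\<^sup>2)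
      - (\<Sum>\<alpha>\<in>UNIV. \<Sum>\<beta>\<in>UNIV. \<eta> \<alpha> \<alpha> * \<eta> \<beta> \<beta> * (A \<alpha> \<beta>)\<^sup>2)"
    unfolding sum_frame_square p_def[symmetric]
    by (simp add: right_diff_distrib sum_subtractf sum_distrib_left mult_ac)
  finally show ?thesis
    unfolding sum_frame_square p_def by simp
qed

end

section \<open>Contraction of the superenergy tensor\<close>

definition contract2 :: "(4 \<Rightarrow> 4 \<Rightarrow> real) \<Rightarrow> real ^ 4 \<Rightarrow> real" where
  "contract2 X u = (\<Sum>\<alpha>\<in>UNIV. \<Sum>\<beta>\<in>UNIV. X \<alpha> \<beta> * lower u \<alpha> * lower u \<beta>)"

lemma contract4_add:
  "contract4 (\<lambda>\<alpha> \<beta> \<gamma> \<delta>. S \<alpha> \<beta> \<gamma> \<delta> + T \<alpha> \<beta> \<gamma> \<delta>) u = contract4 S u + contract4 T u"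
  by (simp add: contract4_def distrib_right sum.distrib)

lemma contract4_diff:
  "contract4 (\<lambda>\<alpha> \<beta> \<gamma> \<delta>. S \<alpha> \<beta> \<gamma> \<delta> - T \<alpha> \<beta> \<gamma> \<delta>) u = contract4 S u - contract4 T u"
  by (simp add: contract4_def left_diff_distrib sum_subtractf)

lemma contract4_cmult:
  "contract4 (\<lambda>\<alpha> \<beta> \<gamma> \<delta>. c * T \<alpha> \<beta> \<gamma> \<delta>) u = c * contract4 T u"
  by (simp add: contract4_def sum_distrib_left mult.assoc)

text \<open>The same covector fills all slots, so permuting indices only renames the summation
  variables. The three adjacent transpositions proved here generate all permutations.\<close>

lemma contract4_swap23:
  "contract4 (\<lambda>\<alpha> \<beta> \<gamma> \<delta>. T \<alpha> \<gamma> \<beta> \<delta>) u = contract4 T u"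
proof -
  have "(\<Sum>\<beta>\<in>UNIV. \<Sum>\<gamma>\<in>UNIV. \<Sum>\<delta>\<in>UNIV.
          T \<alpha> \<gamma> \<beta> \<delta> * lower u \<alpha> * lower u \<beta> * lower u \<gamma> * lower u \<delta>)
      = (\<Sum>\<beta>\<in>UNIV. \<Sum>\<gamma>\<in>UNIV. \<Sum>\<delta>\<in>UNIV.
          T \<alpha> \<beta> \<gamma> \<delta> * lower u \<alpha> * lower u \<beta> * lower u \<gamma> * lower u \<delta>)" for \<alpha>
    by (subst sum.swap) (simp add: mult_ac)
  thus ?thesis by (simp add: contract4_def)
qed

lemma contract4_swap34:
  "contract4 (\<lambda>\<alpha> \<beta> \<gamma> \<delta>. T \<alpha> \<beta> \<delta> \<gamma>) u = contract4 T u"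
proof -
  have "(\<Sum>\<gamma>\<in>UNIV. \<Sum>\<delta>\<in>UNIV.
          T \<alpha> \<beta> \<delta> \<gamma> * lower u \<alpha> * lower u \<beta> * lower u \<gamma> * lower u \<delta>)
      = (\<Sum>\<gamma>\<in>UNIV. \<Sum>\<delta>\<in>UNIV.
          T \<alpha> \<beta> \<gamma> \<delta> * lower u \<alpha> * lower u \<beta> * lower u \<gamma> * lower u \<delta>)" for \<alpha> \<beta>
    by (subst sum.swap) (simp add: mult_ac)
  thus ?thesis by (simp add: contract4_def)
qed

lemma contract4_swap12:
  "contract4 (\<lambda>\<alpha> \<beta> \<gamma> \<delta>. T \<beta> \<alpha> \<gamma> \<delta>) u = contract4 T u"
  unfolding contract4_def by (subst sum.swap) (simp add: mult_ac)

lemma contract4_prod: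
  "contract4 (\<lambda>\<alpha> \<beta> \<gamma> \<delta>. X \<alpha> \<beta> * Y \<gamma> \<delta>) u = contract2 X u * contract2 Y u"
  unfolding contract4_def contract2_def sum_distrib_right
  unfolding sum_distrib_left by (simp only: mult_ac)

text \<open>Together with \<open>contract4_prod\<close> these are the index patterns of the products
  in \<open>W\<close> once its symmetrizations are expanded.\<close>

lemma contract4_prod_perms:
  "contract4 (\<lambda>\<alpha> \<beta> \<gamma> \<delta>. X \<gamma> \<delta> * Y \<alpha> \<beta>) u = contract2 X u * contract2 Y u"
  "contract4 (\<lambda>\<alpha> \<beta> \<gamma> \<delta>. X \<alpha> \<gamma> * Y \<delta> \<beta>) u = contract2 X u * contract2 Y u"
  "contract4 (\<lambda>\<alpha> \<beta> \<gamma> \<delta>. X \<alpha> \<delta> * Y \<gamma> \<beta>) u = contract2 X u * contract2 Y u"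
  "contract4 (\<lambda>\<alpha> \<beta> \<gamma> \<delta>. X \<beta> \<gamma> * Y \<delta> \<alpha>) u = contract2 X u * contract2 Y u"
  "contract4 (\<lambda>\<alpha> \<beta> \<gamma> \<delta>. X \<beta> \<delta> * Y \<gamma> \<alpha>) u = contract2 X u * contract2 Y u"
proof -
  show "contract4 (\<lambda>\<alpha> \<beta> \<gamma> \<delta>. X \<gamma> \<delta> * Y \<alpha> \<beta>) u = contract2 X u * contract2 Y u"
    using contract4_prod[of Y X u] by (simp add: mult.commute)
  \<comment> \<open>The order of indices is reached by the transpositions 23, 34, 23. It is proved
    for all \<open>X\<close> and \<open>Y\<close> so that the remaining patterns can follow from
    it.\<close>
  show 3: "contract4 (\<lambda>\<alpha> \<beta> \<gamma> \<delta>. X \<alpha> \<delta> * Y \<gamma> \<beta>) u = contract2 X u * contract2 Y u" for X Y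
    using contract4_swap23[of "\<lambda>\<alpha> \<beta> \<gamma> \<delta>. X \<alpha> \<delta> * Y \<beta> \<gamma>" u]
      contract4_swap34[of "\<lambda>\<alpha> \<beta> \<gamma> \<delta>. X \<alpha> \<gamma> * Y \<beta> \<delta>" u]
      contract4_swap23[of "\<lambda>\<alpha> \<beta> \<gamma> \<delta>. X \<alpha> \<beta> * Y \<gamma> \<delta>" u]
      contract4_prod[of X Y u] by simp
  show 2: "contract4 (\<lambda>\<alpha> \<beta> \<gamma> \<delta>. X \<alpha> \<gamma> * Y \<delta> \<beta>) u = contract2 X u * contract2 Y u" for X Y
    using contract4_swap34[of "\<lambda>\<alpha> \<beta> \<gamma> \<delta>. X \<alpha> \<delta> * Y \<gamma> \<beta>" u] 3 by simp
  show "contract4 (\<lambda>\<alpha> \<beta> \<gamma> \<delta>. X \<beta> \<gamma> * Y \<delta> \<alpha>) u = contract2 X u * contract2 Y u"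
    using contract4_swap12[of "\<lambda>\<alpha> \<beta> \<gamma> \<delta>. X \<alpha> \<gamma> * Y \<delta> \<beta>" u] 2 by simp
  show "contract4 (\<lambda>\<alpha> \<beta> \<gamma> \<delta>. X \<beta> \<delta> * Y \<gamma> \<alpha>) u = contract2 X u * contract2 Y u"
    using contract4_swap12[of "\<lambda>\<alpha> \<beta> \<gamma> \<delta>. X \<alpha> \<delta> * Y \<gamma> \<beta>" u] 3 by simp
qed

lemma contract2_\<eta>:
  assumes "timelike_unit u"
  shows "contract2 \<eta> u = 1"
proof -
  have "contract2 \<eta> u = (\<Sum>\<alpha>\<in>UNIV. lower u \<alpha> * (\<Sum>\<beta>\<in>UNIV. \<eta> \<alpha> \<beta> * lower u \<beta>))"
    by (simp only: contract2_def sum_distrib_left mult_ac)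
  also have "\<dots> = 1"
    using assms by (simp add: lower_eq timelike_unit_alt power2_eq_square mult_ac)
  finally show ?thesis .
qed

text \<open>The three products of second derivatives contract to the same square, each with weight
  1/3. The six products of \<eta> with \<tau> contract to the same value, each with weight 1/6,
  because \<eta> contracts to 1.\<close>

lemma contract4_W:
  assumes "timelike_unit u"
  shows "contract4 (W m \<phi> x) u = (contract2 (D_uu \<phi> x) u)\<^sup>2 - contract2 (\<tau> m \<phi> x) u"
proof -
  have W_eq: "W m \<phi> x = (\<lambda>\<alpha> \<beta> \<gamma> \<delta>.
     1/3 * (D_uu \<phi> x \<alpha> \<beta> * D_uu \<phi> x \<gamma> \<delta>
            + (D_uu \<phi> x \<alpha> \<gamma> * D_uu \<phi> x \<delta> \<beta> + D_uu \<phi> x \<alpha> \<delta> * D_uu \<phi> x \<gamma> \<beta>))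
     - 1/6 * (\<eta> \<alpha> \<beta> * \<tau> m \<phi> x \<gamma> \<delta> + \<eta> \<gamma> \<delta> * \<tau> m \<phi> x \<alpha> \<beta>
              + (\<eta> \<alpha> \<gamma> * \<tau> m \<phi> x \<delta> \<beta> + \<eta> \<alpha> \<delta> * \<tau> m \<phi> x \<gamma> \<beta>)
              + (\<eta> \<beta> \<gamma> * \<tau> m \<phi> x \<delta> \<alpha> + \<eta> \<beta> \<delta> * \<tau> m \<phi> x \<gamma> \<alpha>)))"
    by (intro ext) (simp add: W_def symmetrize_def add_divide_distrib)
  show ?thesis
    unfolding W_eq contract4_diff contract4_cmult contract4_add contract4_prod contract4_prod_perms
    by (simp add: contract2_\<eta>[OF assms] power2_eq_square)
qed

section \<open>The field quantities in diagonal form\<close>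

lemma D_u_eq: "D_u \<phi> x \<alpha> = \<eta> \<alpha> \<alpha> * D_d \<phi> x \<alpha>"
  by (simp add: D_u_def)

lemma D_ud_eq: "D_ud \<phi> x \<alpha> \<beta> = \<eta> \<alpha> \<alpha> * D_dd \<phi> x \<alpha> \<beta>"
  by (simp add: D_ud_def)

lemma D_uu_eq: "D_uu \<phi> x \<alpha> \<beta> = \<eta> \<alpha> \<alpha> * \<eta> \<beta> \<beta> * D_dd \<phi> x \<alpha> \<beta>"
  by (simp add: D_uu_def mult.assoc flip: sum_distrib_left)

lemma contract2_D_uu:
  "contract2 (D_uu \<phi> x) u = (\<Sum>\<alpha>\<in>UNIV. u $ \<alpha> * (\<Sum>\<beta>\<in>UNIV. u $ \<beta> * D_dd \<phi> x \<alpha> \<beta>))"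
  by (simp add: contract2_def D_uu_eq lower_eq sum_distrib_left mult_ac)

text \<open>The mass is absorbed into the squared quantities
  \<open>m * D_d \<phi> x \<alpha>\<close> and \<open>m\<^sup>2 * \<phi> x\<close>. They are exactly
  what is known to vanish in the equality case, so \<open>m = 0\<close> needs no separate
  treatment.\<close>

lemma K_eq:
  "K m \<phi> x = 1/2 * (\<Sum>\<alpha>\<in>UNIV. \<Sum>\<beta>\<in>UNIV. \<eta> \<alpha> \<alpha> * \<eta> \<beta> \<beta> * (D_dd \<phi> x \<alpha> \<beta>)\<^sup>2)
     - (\<Sum>\<alpha>\<in>UNIV. \<eta> \<alpha> \<alpha> * (m * D_d \<phi> x \<alpha>)\<^sup>2) + 1/2 * (m\<^sup>2 * \<phi> x)\<^sup>2"
  by (simp add: K_def D_uu_eq D_u_eq sum_distrib_left power2_eq_square power4_eq_xxxx mult_ac)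

lemma \<tau>_eq:
  "\<tau> m \<phi> x \<alpha> \<beta> = (\<Sum>\<kappa>\<in>UNIV. \<eta> \<kappa> \<kappa> * (\<eta> \<alpha> \<alpha> * D_dd \<phi> x \<alpha> \<kappa>) * (\<eta> \<beta> \<beta> * D_dd \<phi> x \<beta> \<kappa>))
     - (\<eta> \<alpha> \<alpha> * (m * D_d \<phi> x \<alpha>)) * (\<eta> \<beta> \<beta> * (m * D_d \<phi> x \<beta>)) - 1/2 * K m \<phi> x * \<eta> \<alpha> \<beta>"
  by (simp add: \<tau>_def D_uu_eq D_ud_eq D_u_eq power2_eq_square mult_ac)

text \<open>The signs that raise \<open>w\<close> cancel those in \<open>lower u\<close>. Both
  quadratic terms of \<tau> are built from products of this shape.\<close>

lemma contract2_square:
  "contract2 (\<lambda>\<alpha> \<beta>. (\<eta> \<alpha> \<alpha> * w \<alpha>) * (\<eta> \<beta> \<beta> * w \<beta>)) u = (\<Sum>\<alpha>\<in>UNIV. u $ \<alpha> * w \<alpha>)\<^sup>2"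
  by (simp add: contract2_def lower_eq power2_eq_square sum_product mult_ac)

lemma contract2_\<tau>:
  assumes sym: "\<And>\<alpha> \<beta>. D_dd \<phi> x \<alpha> \<beta> = D_dd \<phi> x \<beta> \<alpha>" and "timelike_unit u"
  shows "contract2 (\<tau> m \<phi> x) u = (\<Sum>\<kappa>\<in>UNIV. \<eta> \<kappa> \<kappa> * (\<Sum>\<beta>\<in>UNIV. u $ \<beta> * D_dd \<phi> x \<kappa> \<beta>)\<^sup>2)
     - (\<Sum>\<alpha>\<in>UNIV. u $ \<alpha> * (m * D_d \<phi> x \<alpha>))\<^sup>2 - 1/2 * K m \<phi> x"
proof -
  \<comment> \<open>Symmetry brings the summed index \<kappa> to the front, so for fixed \<kappa>
    this is the raised covector \<open>D_dd \<phi> x \<kappa>\<close> multiplied by itself, as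
    \<open>contract2_square\<close> requires.\<close>
  let ?S = "\<lambda>\<alpha> \<beta> \<kappa>. (\<eta> \<alpha> \<alpha> * D_dd \<phi> x \<kappa> \<alpha>) * (\<eta> \<beta> \<beta> * D_dd \<phi> x \<kappa> \<beta>)"
  have \<tau>: "\<tau> m \<phi> x = (\<lambda>\<alpha> \<beta>. (\<Sum>\<kappa>\<in>UNIV. \<eta> \<kappa> \<kappa> * ?S \<alpha> \<beta> \<kappa>)
     - (\<eta> \<alpha> \<alpha> * (m * D_d \<phi> x \<alpha>)) * (\<eta> \<beta> \<beta> * (m * D_d \<phi> x \<beta>)) - 1/2 * K m \<phi> x * \<eta> \<alpha> \<beta>)"
    by (intro ext) (simp only: \<tau>_eq sym mult.assoc)
  have diff: "contract2 (\<lambda>\<alpha> \<beta>. X \<alpha> \<beta> - Y \<alpha> \<beta>) u = contract2 X u - contract2 Y u" for X Y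
    by (simp add: contract2_def left_diff_distrib sum_subtractf)
  have cmult: "contract2 (\<lambda>\<alpha> \<beta>. c * X \<alpha> \<beta>) u = c * contract2 X u" for c X
    by (simp add: contract2_def sum_distrib_left mult.assoc)
  have sum: "contract2 (\<lambda>\<alpha> \<beta>. \<Sum>\<kappa>\<in>UNIV. X \<alpha> \<beta> \<kappa>) u = (\<Sum>\<kappa>\<in>UNIV. contract2 (\<lambda>\<alpha> \<beta>. X \<alpha> \<beta> \<kappa>) u)"
    for X :: "4 \<Rightarrow> 4 \<Rightarrow> 4 \<Rightarrow> real"
  proof -
    have "contract2 (\<lambda>\<alpha> \<beta>. \<Sum>\<kappa>\<in>UNIV. X \<alpha> \<beta> \<kappa>) u
        = (\<Sum>\<alpha>\<in>UNIV. \<Sum>\<kappa>\<in>UNIV. \<Sum>\<beta>\<in>UNIV. X \<alpha> \<beta> \<kappa> * lower u \<alpha> * lower u \<beta>)"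
      unfolding contract2_def sum_distrib_right by (intro sum.cong refl sum.swap)
    also have "\<dots> = (\<Sum>\<kappa>\<in>UNIV. contract2 (\<lambda>\<alpha> \<beta>. X \<alpha> \<beta> \<kappa>) u)"
      unfolding contract2_def by (rule sum.swap)
    finally show ?thesis .
  qed
  show ?thesis
    unfolding \<tau> diff cmult sum contract2_square contract2_\<eta>[OF \<open>timelike_unit u\<close>] by simp
qed

theorem theorem4:
  fixes m :: real and \<phi> :: "spacetime \<Rightarrow> real"
  assumes "m \<ge> 0"
    and "C2_field \<phi>"
    and "klein_gordon m \<phi>"
  shows "\<forall>x u. timelike_unit u \<longrightarrow>
           contract4 (W m \<phi> x) u \<ge> 0 \<and>
           (contract4 (W m \<phi> x) u = 0 \<longrightarrow> (\<forall>\<alpha> \<beta> \<gamma> \<delta>. W m \<phi> x \<alpha> \<beta> \<gamma> \<delta> = 0))"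
proof (intro allI impI)
  fix x u
  assume u: "timelike_unit u"
  from rest_frame_exists[OF u] obtain E :: "4 \<Rightarrow> 4 \<Rightarrow> real"
    where E0: "\<And>\<alpha>. E 0 \<alpha> = u $ \<alpha>"
      and EE: "\<And>\<alpha> \<beta>. (\<Sum>a\<in>UNIV. E a \<alpha> * E a \<beta>) = 2 * u $ \<alpha> * u $ \<beta> - \<eta> \<alpha> \<beta>"
    by blast
  define A where "A = D_dd \<phi> x"
  define w where "w \<alpha> = m * D_d \<phi> x \<alpha>" for \<alpha>
  have sym: "A \<alpha> \<beta> = A \<beta> \<alpha>" for \<alpha> \<beta>
    unfolding A_def D_dd_def by (rule partial_commute[OF \<open>C2_field \<phi>\<close>])
  define P where "P = (\<Sum>b\<in>UNIV. \<Sum>a\<in>UNIV. (\<Sum>\<alpha>\<in>UNIV. E a \<alpha> * (\<Sum>\<beta>\<in>UNIV. E b \<beta> * A \<alpha> \<beta>))\<^sup>2)"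
  define Q where "Q = (\<Sum>a\<in>UNIV. (\<Sum>\<alpha>\<in>UNIV. E a \<alpha> * w \<alpha>)\<^sup>2)"
  have P_eq: "P = 4 * (\<Sum>\<alpha>\<in>UNIV. u $ \<alpha> * (\<Sum>\<beta>\<in>UNIV. u $ \<beta> * A \<alpha> \<beta>))\<^sup>2
       - 4 * (\<Sum>\<alpha>\<in>UNIV. \<eta> \<alpha> \<alpha> * (\<Sum>\<beta>\<in>UNIV. u $ \<beta> * A \<alpha> \<beta>)\<^sup>2)
       + (\<Sum>\<alpha>\<in>UNIV. \<Sum>\<beta>\<in>UNIV. \<eta> \<alpha> \<alpha> * \<eta> \<beta> \<beta> * (A \<alpha> \<beta>)\<^sup>2)"
    unfolding P_def by (rule sum_frame_square2[OF E0 EE sym])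
  have Q_eq: "Q = 2 * (\<Sum>\<alpha>\<in>UNIV. u $ \<alpha> * w \<alpha>)\<^sup>2 - (\<Sum>\<alpha>\<in>UNIV. \<eta> \<alpha> \<alpha> * (w \<alpha>)\<^sup>2)"
    unfolding Q_def by (rule sum_frame_square[OF E0 EE])
  \<comment> \<open>Here \<open>a\<close>, \<open>b\<close>, \<open>d\<close> are the three sums in
    \<open>P_eq\<close>, \<open>c\<close> and \<open>e\<close> those in \<open>Q_eq\<close>, and
    \<open>f\<close> is the square of \<open>m\<^sup>2 * \<phi> x\<close>. The terms of indefinite
    sign, \<open>b\<close>, \<open>d\<close> and \<open>e\<close>, occur with just the weights that
    complete \<open>P\<close> and \<open>Q\<close>.\<close>
  have collect: "a - (b - c - 1/2 * (1/2 * d - e + 1/2 * f))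
      = 1/4 * (4 * a - 4 * b + d) + 1/2 * (2 * c - e) + 1/4 * f" for a b c d e f :: real
    by (simp add: field_simps)
  have W_squares: "contract4 (W m \<phi> x) u = 1/4 * P + 1/2 * Q + 1/4 * (m\<^sup>2 * \<phi> x)\<^sup>2"
    unfolding contract4_W[OF u] contract2_D_uu contract2_\<tau>[OF sym[unfolded A_def] u] K_eq
      P_eq Q_eq A_def w_def
    by (rule collect)
  have nonneg: "P \<ge> 0" "Q \<ge> 0"
    unfolding P_def Q_def by (intro sum_nonneg zero_le_power2)+
  have "W m \<phi> x \<alpha> \<beta> \<gamma> \<delta> = 0" if "contract4 (W m \<phi> x) u = 0" for \<alpha> \<beta> \<gamma> \<delta>
  proof -
    \<comment> \<open>Three nonnegative terms with positive weights have sum zero.\<close>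
    have "P = 0" "Q = 0" and "(m\<^sup>2 * \<phi> x)\<^sup>2 = 0"
      using that nonneg zero_le_power2[of "m\<^sup>2 * \<phi> x"] unfolding W_squares by linarith+
    hence mass: "m\<^sup>2 * \<phi> x = 0" by (simp only: power_eq_0_iff)
    have "(\<Sum>\<alpha>\<in>UNIV. E a \<alpha> * (\<Sum>\<beta>\<in>UNIV. E b \<beta> * A \<alpha> \<beta>)) = 0" for a b
      using \<open>P = 0\<close> unfolding P_def by (simp add: sum_nonneg_eq_0_iff sum_nonneg)
    \<comment> \<open>The frame is stripped from one index of \<open>A\<close> at a time: here from
      the first, for every fixed \<open>b\<close>, and then from the second.\<close>
    hence "(\<Sum>\<beta>\<in>UNIV. E b \<beta> * A \<alpha> \<beta>) = 0" for \<alpha> b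
      using frame_components_eq_0[OF E0 EE, of "\<lambda>\<alpha>. \<Sum>\<beta>\<in>UNIV. E b \<beta> * A \<alpha> \<beta>"] by blast
    hence A0: "A \<alpha> \<beta> = 0" for \<alpha> \<beta>
      using frame_components_eq_0[OF E0 EE, of "A \<alpha>"] by blast
    have "(\<Sum>\<alpha>\<in>UNIV. E a \<alpha> * w \<alpha>) = 0" for a
      using \<open>Q = 0\<close> unfolding Q_def by (simp add: sum_nonneg_eq_0_iff)
    hence w0: "w \<alpha> = 0" for \<alpha>
      using frame_components_eq_0[OF E0 EE, of w] by blast
    have "K m \<phi> x = 0"
      unfolding K_eq mass A_def[symmetric] w_def[symmetric] by (simp add: A0 w0)
    hence "\<tau> m \<phi> x \<alpha> \<beta> = 0" for \<alpha> \<beta>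
      unfolding \<tau>_eq A_def[symmetric] w_def[symmetric] by (simp add: A0 w0)
    thus ?thesis
      using A0 by (simp add: W_def symmetrize_def D_uu_eq A_def)
  qed
  with nonneg show "contract4 (W m \<phi> x) u \<ge> 0 \<and>
      (contract4 (W m \<phi> x) u = 0 \<longrightarrow> (\<forall>\<alpha> \<beta> \<gamma> \<delta>. W m \<phi> x \<alpha> \<beta> \<gamma> \<delta> = 0))"
    by (simp add: W_squares)
qed

end
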